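(* For every $c>1$ there exists a continuous function $f:[0,1]\to\mathbb{R}$ whose graph $\{(x,f(x)):x\in[0,1]\}\subseteq\mathbb{R}^2$ is symmetrically $c$-monotone, and such that the set of points $x\in[0,1]$ at which $f$ has a derivative (finite or infinite) has Lebesgue measure zero.
   Context: A metric space $(X,d)$ is symmetrically $c$-monotone if there is a linear order $<$ on $X$ such that $\max(d(x,y),d(y,z))\le c\,d(x,z)$ whenever $x<y<z$ in $X$. The graph is a subset of $\mathbb{R}^2$ with the Euclidean metric. *)

theory Defs
  imports "HOL-Analysis.Analysis"
begin

definition sym_c_monotone :: "real \<Rightarrow> 'a::metric_space set \<Rightarrow> bool" where
  "sym_c_monotone c S \<longleftrightarrow>
     (\<exists>r. linear_order_on S r \<and>
        (\<forall>x\<in>S. \<forall>y\<in>S. \<forall>z\<in>S.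
           (x, y) \<in> r \<and> x \<noteq> y \<and> (y, z) \<in> r \<and> y \<noteq> z \<longrightarrow>
           max (dist x y) (dist y z) \<le> c * dist x z))"

text \<open>Graph of f over [0,1] as a subset of R^2 (real * real carries the Euclidean metric).\<close>
definition graph01 :: "(real \<Rightarrow> real) \<Rightarrow> (real \<times> real) set" where
  "graph01 f = {(x, f x) | x. x \<in> {0..1}}"

definition has_infinite_derivative_01 :: "(real \<Rightarrow> real) \<Rightarrow> real \<Rightarrow> bool" where
  "has_infinite_derivative_01 f x \<longleftrightarrow>
     filterlim (\<lambda>y. (f y - f x) / (y - x)) at_top (at x within {0..1}) \<or>
     filterlim (\<lambda>y. (f y - f x) / (y - x)) at_bot (at x within {0..1})"

definition deriv_points_01 :: "(real \<Rightarrow> real) \<Rightarrow> real set" where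
  "deriv_points_01 f = {x \<in> {0..1}. f differentiable (at x within {0..1})
                                     \<or> has_infinite_derivative_01 f x}"

end

theory Submission
  imports Defs
begin

text \<open>The function is a small multiple of the lacunary series
  \<open>g x = (\<Sum>n. sin (100^n * x) / 100^n)\<close>.  On every interval of length \<open>h\<close> it stays within \<open>O(h)\<close>
  of its chord: the terms with \<open>100^n * h \<le> 1\<close> are controlled by their second derivative, the others
  by their size.  As two points of a graph over an interval of length \<open>h\<close> are at least \<open>h\<close> apart,
  after scaling by a small factor every intermediate point is so close to the chord that the graph,
  ordered by abscissa, is symmetrically \<open>c\<close>-monotone.

  The difference quotients of \<open>g\<close> at \<open>x\<close> with steps \<open>2 * pi / 100^n\<close> and \<open>pi / 100^n\<close> only see
  the first terms of the series; if they converged, both \<open>cos (100^n * x)\<close> and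
  \<open>sin (100^n * x)\<close> would eventually be small.  Hence \<open>g\<close> has no finite derivative anywhere.
  An infinite derivative exists only on a null set, for any function at all: locally the function
  is injective on that set, and its inverse has derivative 0, so Sard's lemma applies.\<close>

section \<open>A lacunary series\<close>

text \<open>The base 100 is even, so half a period of one term is a whole number of periods of each
  later term. It is also large, so in difference quotients at the scale of term \<open>n\<close> the
  error of all earlier terms together is small.\<close>

definition lacunary_term :: "nat \<Rightarrow> real \<Rightarrow> real" where
  "lacunary_term n x = sin (100 ^ n * x) / 100 ^ n"

definition lacunary :: "real \<Rightarrow> real" where
  "lacunary x = (\<Sum>n. lacunary_term n x)"

lemma abs_lacunary_term_le: "\<bar>lacunary_term n x\<bar> \<le> (1 / 100) ^ n"
  by (simp add: lacunary_term_def abs_divide power_one_over divide_right_mono)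

lemma summable_lacunary_term: "summable (\<lambda>n. lacunary_term n x)"
  by (rule summable_comparison_test'[of "\<lambda>n. (1 / 100) ^ n" 0])
    (auto simp: abs_lacunary_term_le intro: summable_geometric)

lemma continuous_on_lacunary: "continuous_on S lacunary"
proof -
  have "uniform_limit S (\<lambda>n x. \<Sum>i<n. lacunary_term i x) lacunary sequentially"
    unfolding lacunary_def[abs_def]
    by (rule Weierstrass_m_test[of _ _ "\<lambda>n. (1 / 100) ^ n"])
      (auto simp: abs_lacunary_term_le intro: summable_geometric)
  then show ?thesis
    by (rule uniform_limit_theorem[rotated])
      (auto simp: lacunary_term_def intro!: always_eventually continuous_intros)
qed

text \<open>Mean value theorem. The derivative \<open>cos (100 ^ n * x)\<close> has amplitude 1 at
  every scale, which is what prevents convergence later. The value \<open>s = 0\<close> is allowed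
  because the intermediate point of a chord may be its left end.\<close>

lemma lacunary_term_increment:
  assumes "s \<ge> 0"
  shows "\<exists>\<xi>. x \<le> \<xi> \<and> \<xi> \<le> x + s \<and> lacunary_term n (x + s) - lacunary_term n x = s * cos (100 ^ n * \<xi>)"
proof (cases "s = 0")
  case False
  have "(lacunary_term n has_real_derivative cos (100 ^ n * u)) (at u)" for u
    unfolding lacunary_term_def[abs_def] by (auto intro!: derivative_eq_intros)
  then obtain \<xi> where "x < \<xi>" "\<xi> < x + s"
    "lacunary_term n (x + s) - lacunary_term n x = (x + s - x) * cos (100 ^ n * \<xi>)"
    using MVT2[of x "x + s" "lacunary_term n" "\<lambda>u. cos (100 ^ n * u)"] assms False by force
  then show ?thesis by (intro exI[of _ \<xi>]) auto
qed auto

lemma abs_cos_diff_le: "\<bar>cos u - cos v\<bar> \<le> \<bar>u - v\<bar>" for u v :: real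
proof -
  have "norm (cos u - cos v) \<le> 1 * norm (u - v)"
    by (rule field_differentiable_bound[of UNIV cos "\<lambda>u. - sin u"])
      (auto intro!: derivative_eq_intros)
  then show ?thesis by simp
qed

lemma abs_cos_scaled_diff_le:
  fixes x h \<xi> \<eta> :: real
  assumes "x \<le> \<xi>" "\<xi> \<le> x + h" "x \<le> \<eta>" "\<eta> \<le> x + h"
  shows "\<bar>cos (100 ^ n * \<xi>) - cos (100 ^ n * \<eta>)\<bar> \<le> 100 ^ n * h"
proof -
  have "\<bar>cos (100 ^ n * \<xi>) - cos (100 ^ n * \<eta>)\<bar> \<le> \<bar>100 ^ n * \<xi> - 100 ^ n * \<eta>\<bar>"
    by (rule abs_cos_diff_le)
  also have "\<dots> = 100 ^ n * \<bar>\<xi> - \<eta>\<bar>"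
    by (simp add: abs_mult flip: right_diff_distrib)
  also have "\<dots> \<le> 100 ^ n * h"
    using assms by (intro mult_left_mono) auto
  finally show ?thesis .
qed

subsection \<open>Distance to the chords\<close>

text \<open>The signed vertical distance from the chord over the interval from \<open>x\<close> to
  \<open>x + h\<close>, at parameter \<open>t\<close>. It is linear in \<open>f\<close>, so it can
  be bounded term by term along the series.\<close>

definition chord_gap :: "(real \<Rightarrow> real) \<Rightarrow> real \<Rightarrow> real \<Rightarrow> real \<Rightarrow> real" where
  "chord_gap f x h t = f (x + t * h) - (1 - t) * f x - t * f (x + h)"

text \<open>The gap is \<open>t * h\<close> times the difference of two mean slopes, both taken in
  the same interval of length \<open>h\<close>. The bound is useful while \<open>100 ^ n * h\<close>
  is at most 1.\<close>

lemma chord_gap_lacunary_term_small_scale: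
  assumes "h > 0" "0 \<le> t" "t \<le> 1"
  shows "\<bar>chord_gap (lacunary_term n) x h t\<bar> \<le> 100 ^ n * h\<^sup>2"
proof -
  have th: "0 \<le> t * h" "t * h \<le> h"
    using assms by (auto simp: mult_left_le_one_le)
  obtain \<xi> where \<xi>: "x \<le> \<xi>" "\<xi> \<le> x + t * h"
    "lacunary_term n (x + t * h) - lacunary_term n x = t * h * cos (100 ^ n * \<xi>)"
    using lacunary_term_increment[OF th(1)] by blast
  obtain \<eta> where \<eta>: "x \<le> \<eta>" "\<eta> \<le> x + h"
    "lacunary_term n (x + h) - lacunary_term n x = h * cos (100 ^ n * \<eta>)"
    using lacunary_term_increment[OF less_imp_le[OF \<open>h > 0\<close>]] by blast
  have "chord_gap (lacunary_term n) x h t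
      = (lacunary_term n (x + t * h) - lacunary_term n x) - t * (lacunary_term n (x + h) - lacunary_term n x)"
    by (simp add: chord_gap_def algebra_simps)
  also have "\<dots> = t * h * (cos (100 ^ n * \<xi>) - cos (100 ^ n * \<eta>))"
    unfolding \<xi>(3) \<eta>(3) by (simp add: algebra_simps)
  finally have "\<bar>chord_gap (lacunary_term n) x h t\<bar> = t * h * \<bar>cos (100 ^ n * \<xi>) - cos (100 ^ n * \<eta>)\<bar>"
    using assms by (simp add: abs_mult)
  also have "\<dots> \<le> h * (100 ^ n * h)"
  proof (rule mult_mono[OF th(2)])
    show "\<bar>cos (100 ^ n * \<xi>) - cos (100 ^ n * \<eta>)\<bar> \<le> 100 ^ n * h"
      using \<xi>(1) order_trans[OF \<xi>(2) add_left_mono[OF th(2)]] \<eta>(1,2) by (rule abs_cos_scaled_diff_le)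
  qed (use \<open>h > 0\<close> in simp_all)
  finally show ?thesis by (simp add: power2_eq_square mult_ac)
qed

lemma chord_gap_lacunary_term_large_scale:
  assumes "0 \<le> t" "t \<le> 1"
  shows "\<bar>chord_gap (lacunary_term n) x h t\<bar> \<le> 2 * (1 / 100) ^ n"
proof -
  let ?M = "(1 / 100 :: real) ^ n"
  have "\<bar>(1 - t) * lacunary_term n x\<bar> \<le> (1 - t) * ?M" "\<bar>t * lacunary_term n (x + h)\<bar> \<le> t * ?M"
    using assms by (simp_all add: abs_mult abs_lacunary_term_le mult_left_mono)
  then have "\<bar>chord_gap (lacunary_term n) x h t\<bar> \<le> ?M + (1 - t) * ?M + t * ?M"
    using abs_lacunary_term_le[of n "x + t * h"]
    unfolding chord_gap_def abs_le_iff by (intro conjI; linarith)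
  then show ?thesis by (simp add: algebra_simps)
qed

lemma sum_power_100: "(\<Sum>k<n. 100 ^ k) = (100 ^ n - 1) / (99::real)"
  by (induction n) auto

text \<open>The sum is split at the first scale not exceeding \<open>h\<close>. On either side the
  applicable bounds form a geometric sum dominated by the term next to the split, hence of order
  \<open>h\<close>.\<close>

lemma sum_chord_gap_lacunary_term:
  assumes h: "h > 0" and t: "0 \<le> t" "t \<le> 1"
  shows "(\<Sum>n<M. \<bar>chord_gap (lacunary_term n) x h t\<bar>) \<le> 6 * h"
proof -
  let ?d = "\<lambda>n. \<bar>chord_gap (lacunary_term n) x h t\<bar>"
  define N where "N = (LEAST n. (1 / 100) ^ n \<le> h)"
  have "\<exists>n. (1 / 100) ^ n < h" using real_arch_pow_inv[OF h, of "1 / 100"] by simp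
  then have N: "(1 / 100) ^ N \<le> h"
    unfolding N_def by (metis (mono_tags, lifting) LeastI less_imp_le)
  have low: "(\<Sum>n<N. ?d n) \<le> 2 * h"
  proof (cases N)
    case (Suc K)
    \<comment> \<open>By minimality of \<open>N\<close>, the index \<open>K\<close> just before it
      still has a scale larger than \<open>h\<close>.\<close>
    then have "h < (1 / 100) ^ K"
      unfolding N_def by (metis (mono_tags, lifting) lessI not_less_Least not_le)
    then have K: "100 ^ K * h < 1" by (simp add: field_simps power_one_over)
    have "(\<Sum>n<N. ?d n) \<le> (\<Sum>n<N. 100 ^ n * h\<^sup>2)"
      by (intro sum_mono chord_gap_lacunary_term_small_scale assms)
    also have "\<dots> = (100 ^ N - 1) / 99 * h\<^sup>2"
      by (simp add: sum_power_100 flip: sum_distrib_right)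
    also have "\<dots> \<le> 2 * 100 ^ K * h\<^sup>2"
    proof (rule mult_right_mono)
      have "(100 ^ N - 1) / 99 \<le> (100 * 100 ^ K) / (99::real)"
        by (intro divide_right_mono) (auto simp: Suc)
      also have "\<dots> \<le> 2 * 100 ^ K" by simp
      finally show "(100 ^ N - 1) / 99 \<le> 2 * (100::real) ^ K" .
    qed simp
    also have "\<dots> = 2 * (100 ^ K * h) * h" by (simp add: power2_eq_square)
    also have "\<dots> \<le> 2 * 1 * h"
      using K h by (intro mult_right_mono mult_left_mono) auto
    finally show ?thesis by simp
  qed (use h in simp)
  have high: "(\<Sum>n=N..<N+M. ?d n) \<le> 4 * h"
  proof -
    have "(\<Sum>n=N..<N+M. ?d n) \<le> (\<Sum>n=N..<N+M. 2 * (1 / 100) ^ n)"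
      by (intro sum_mono chord_gap_lacunary_term_large_scale t)
    also have "\<dots> = 2 * (1 / 100) ^ N * (\<Sum>n<M. (1 / 100) ^ n)"
      using sum.shift_bounds_nat_ivl[of "\<lambda>n. 2 * (1 / 100 :: real) ^ n" 0 N M]
      by (simp add: add.commute atLeast0LessThan power_add sum_distrib_left mult_ac)
    also have "(\<Sum>n<M. (1 / 100 :: real) ^ n) \<le> 2"
    proof -
      have "(\<Sum>n<M. (1 / 100 :: real) ^ n) = (1 - (1 / 100) ^ M) / (1 - 1 / 100)"
        by (simp add: sum_gp_strict)
      also have "\<dots> \<le> 1 / (1 - 1 / 100)"
        by (intro divide_right_mono) auto
      finally show ?thesis by simp
    qed
    then have "2 * (1 / 100) ^ N * (\<Sum>n<M. (1 / 100 :: real) ^ n) \<le> 2 * (1 / 100) ^ N * 2"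
      by (intro mult_left_mono) auto
    also have "\<dots> \<le> 4 * h" using N by simp
    finally show ?thesis .
  qed
  \<comment> \<open>Lengthening the sum to \<open>N + M\<close> avoids distinguishing whether
    \<open>M\<close> lies before or after the split.\<close>
  have "(\<Sum>n<M. ?d n) \<le> (\<Sum>n<N+M. ?d n)"
    by (rule sum_mono2) auto
  also have "\<dots> = (\<Sum>n<N. ?d n) + (\<Sum>n=N..<N+M. ?d n)"
    using sum.atLeastLessThan_concat[of 0 N "N + M" ?d] by (simp add: atLeast0LessThan)
  finally show ?thesis using low high by linarith
qed

lemma chord_gap_lacunary:
  assumes "h > 0" "0 \<le> t" "t \<le> 1"
  shows "\<bar>chord_gap lacunary x h t\<bar> \<le> 6 * h"
proof -
  have "(\<lambda>n. chord_gap (lacunary_term n) x h t) sums chord_gap lacunary x h t"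
    unfolding chord_gap_def lacunary_def
    by (intro sums_diff sums_mult summable_sums summable_lacunary_term)
  then have "(\<lambda>M. \<bar>\<Sum>n<M. chord_gap (lacunary_term n) x h t\<bar>) \<longlonglongrightarrow> \<bar>chord_gap lacunary x h t\<bar>"
    unfolding sums_def by (rule tendsto_rabs)
  moreover have "\<bar>\<Sum>n<M. chord_gap (lacunary_term n) x h t\<bar> \<le> 6 * h" for M
    using sum_abs sum_chord_gap_lacunary_term[OF assms] by (rule order_trans)
  ultimately show ?thesis by (meson LIMSEQ_le_const2)
qed

subsection \<open>Difference quotients\<close>

lemma sin_add_multiple_2pi: "sin (u + 2 * pi * real m) = sin u"
  using sin_int_2pin[of "int m"] cos_int_2pin[of "int m"] by (simp add: sin_add)

lemma lacunary_term_periodic: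
  assumes "n \<le> k"
  shows "lacunary_term k (x + 2 * pi / 100 ^ n) = lacunary_term k x"
proof -
  have "(100::real) ^ k = 100 ^ n * 100 ^ (k - n)"
    using assms by (simp flip: power_add)
  then have "100 ^ k * (x + 2 * pi / 100 ^ n) = 100 ^ k * x + 2 * pi * real (100 ^ (k - n))"
    by (simp add: field_simps)
  then show ?thesis by (simp only: lacunary_term_def sin_add_multiple_2pi)
qed

text \<open>The inequality must be strict: for \<open>k > n\<close> the shift amounts to
  \<open>50 * 100 ^ (k - Suc n)\<close> full periods, while for \<open>k = n\<close> it reverses the
  sign.\<close>

lemma lacunary_term_half_periodic:
  assumes "n < k"
  shows "lacunary_term k (x + pi / 100 ^ n) = lacunary_term k x"
proof -
  have "(100::real) ^ k = 100 ^ n * (100 * 100 ^ (k - Suc n))"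
    using assms by (simp flip: power_add power_Suc)
  then have "100 ^ k * (x + pi / 100 ^ n) = 100 ^ k * x + 2 * pi * real (50 * 100 ^ (k - Suc n))"
    by (simp add: field_simps)
  then show ?thesis by (simp only: lacunary_term_def sin_add_multiple_2pi)
qed

lemma lacunary_term_half_period:
  "lacunary_term n (x + pi / 100 ^ n) - lacunary_term n x = - 2 * sin (100 ^ n * x) / 100 ^ n"
proof -
  have "100 ^ n * (x + pi / 100 ^ n) = 100 ^ n * x + pi" by (simp add: field_simps)
  then show ?thesis by (simp add: lacunary_term_def)
qed

lemma lacunary_increment:
  assumes "\<And>k. k \<ge> n \<Longrightarrow> lacunary_term k (x + s) = lacunary_term k x"
  shows "lacunary (x + s) - lacunary x = (\<Sum>k<n. lacunary_term k (x + s) - lacunary_term k x)"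
proof -
  have "lacunary (x + s) - lacunary x = (\<Sum>k. lacunary_term k (x + s) - lacunary_term k x)"
    unfolding lacunary_def by (intro suminf_diff summable_lacunary_term)
  also have "\<dots> = (\<Sum>k<n. lacunary_term k (x + s) - lacunary_term k x)"
    using assms by (intro suminf_finite) auto
  finally show ?thesis .
qed

text \<open>Each quotient is a cosine at a point within \<open>s\<close> of \<open>x\<close>, so
  replacing it by the cosine at \<open>x\<close> costs at most \<open>100 ^ k * s\<close>; these
  errors form a geometric sum.\<close>

lemma low_frequency_quotient:
  assumes "s > 0"
  shows "\<bar>(\<Sum>k<n. lacunary_term k (x + s) - lacunary_term k x) / s - (\<Sum>k<n. cos (100 ^ k * x))\<bar>
    \<le> 100 ^ n * s / 99"
proof -
  have "\<bar>(lacunary_term k (x + s) - lacunary_term k x) / s - cos (100 ^ k * x)\<bar> \<le> 100 ^ k * s" for k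
  proof -
    obtain \<xi> where "x \<le> \<xi>" "\<xi> \<le> x + s"
      "lacunary_term k (x + s) - lacunary_term k x = s * cos (100 ^ k * \<xi>)"
      using lacunary_term_increment[OF less_imp_le[OF assms]] by blast
    then show ?thesis
      using assms abs_cos_scaled_diff_le[of x \<xi> s x k] by simp
  qed
  then have "\<bar>(\<Sum>k<n. lacunary_term k (x + s) - lacunary_term k x) / s - (\<Sum>k<n. cos (100 ^ k * x))\<bar>
      \<le> (\<Sum>k<n. 100 ^ k * s)"
    unfolding sum_divide_distrib sum_subtractf[symmetric]
    by (intro order_trans[OF sum_abs] sum_mono)
  also have "\<dots> = (100 ^ n - 1) / 99 * s"
    by (simp add: sum_power_100 flip: sum_distrib_right)
  also have "\<dots> \<le> 100 ^ n * s / 99"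
    using assms by (simp add: field_simps)
  finally show ?thesis .
qed

lemma pi_less_4: "pi < 4"
  using pi_half_less_two by simp

text \<open>All terms from index \<open>n\<close> on cancel, and the remaining error is at most
  \<open>2 * pi / 99\<close>.\<close>

lemma full_period_quotient:
  "\<bar>(lacunary (x + 2 * pi / 100 ^ n) - lacunary x) / (2 * pi / 100 ^ n) - (\<Sum>k<n. cos (100 ^ k * x))\<bar> \<le> 1 / 10"
proof -
  have eq: "lacunary (x + 2 * pi / 100 ^ n) - lacunary x
      = (\<Sum>k<n. lacunary_term k (x + 2 * pi / 100 ^ n) - lacunary_term k x)"
    by (rule lacunary_increment) (rule lacunary_term_periodic)
  have "\<bar>(lacunary (x + 2 * pi / 100 ^ n) - lacunary x) / (2 * pi / 100 ^ n) - (\<Sum>k<n. cos (100 ^ k * x))\<bar>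
      \<le> 100 ^ n * (2 * pi / 100 ^ n) / 99"
    unfolding eq by (rule low_frequency_quotient) simp
  also have "\<dots> \<le> 1 / 10" using pi_less_4 by simp
  finally show ?thesis .
qed

text \<open>Now term \<open>n\<close> survives as well: its sign flips, and it contributes the extra
  sine.\<close>

lemma half_period_quotient:
  "\<bar>(lacunary (x + pi / 100 ^ n) - lacunary x) / (pi / 100 ^ n)
      - ((\<Sum>k<n. cos (100 ^ k * x)) - 2 / pi * sin (100 ^ n * x))\<bar> \<le> 1 / 20"
proof -
  let ?s = "pi / 100 ^ n :: real"
  let ?L = "\<Sum>k<n. lacunary_term k (x + ?s) - lacunary_term k x"
  have "lacunary (x + ?s) - lacunary x = ?L - 2 * sin (100 ^ n * x) / 100 ^ n"
    by (subst lacunary_increment[of "Suc n"])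
      (auto simp: lacunary_term_half_periodic lacunary_term_half_period)
  then have "(lacunary (x + ?s) - lacunary x) / ?s = ?L / ?s - 2 / pi * sin (100 ^ n * x)"
    by (simp add: field_simps)
  moreover have "\<bar>?L / ?s - (\<Sum>k<n. cos (100 ^ k * x))\<bar> \<le> 100 ^ n * ?s / 99"
    by (rule low_frequency_quotient) simp
  moreover have "100 ^ n * ?s / 99 \<le> 1 / 20" using pi_less_4 by simp
  ultimately show ?thesis
    unfolding abs_le_iff by (intro conjI; linarith)
qed

text \<open>The steps go to the right and must stay in the unit interval, hence
  \<open>x < 1\<close>.\<close>

lemma lacunary_not_differentiable:
  assumes "0 \<le> x" "x < 1"
  shows "\<not> lacunary differentiable (at x within {0..1})"
proof
  assume "lacunary differentiable (at x within {0..1})"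
  then obtain D where D: "((\<lambda>y. (lacunary y - lacunary x) / (y - x)) \<longlongrightarrow> D) (at x within {0..1})"
    unfolding real_differentiable_def has_field_derivative_iff by blast
  have quotient: "(\<lambda>n. (lacunary (x + a / 100 ^ n) - lacunary x) / (a / 100 ^ n)) \<longlonglongrightarrow> D"
    if "a > 0" for a :: real
  proof -
    have lim: "(\<lambda>n. x + a / 100 ^ n) \<longlonglongrightarrow> x"
      using tendsto_add[OF tendsto_const[of x] tendsto_mult[OF tendsto_const[of a]
            LIMSEQ_realpow_zero[of "1 / 100"]]]
      by (simp add: power_one_over)
    have "eventually (\<lambda>n. x + a / 100 ^ n \<in> {0..1} - {x}) sequentially"
      using order_tendstoD(2)[OF lim \<open>x < 1\<close>]
      by eventually_elim (use assms \<open>a > 0\<close> in auto)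
    then have "filterlim (\<lambda>n. x + a / 100 ^ n) (at x within {0..1}) sequentially"
      using lim unfolding filterlim_at by (auto elim: eventually_mono)
    from filterlim_compose[OF D this] show ?thesis by simp
  qed
  define F where "F n = (lacunary (x + 2 * pi / 100 ^ n) - lacunary x) / (2 * pi / 100 ^ n)" for n :: nat
  define H where "H n = (lacunary (x + pi / 100 ^ n) - lacunary x) / (pi / 100 ^ n)" for n :: nat
  have F: "F \<longlonglongrightarrow> D" and H: "H \<longlonglongrightarrow> D"
    unfolding F_def[abs_def] H_def[abs_def] using quotient[of "2 * pi"] quotient[of pi] by simp_all
  \<comment> \<open>The first difference isolates \<open>cos (100 ^ n * x)\<close> and the second
    \<open>2 / pi * sin (100 ^ n * x)\<close>, up to the quotient errors. Adding these errors to
    1/20 gives the bounds 1/4 and 1/5, too small for squares that sum to 1.\<close>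
  have "(\<lambda>n. F (Suc n) - F n) \<longlonglongrightarrow> D - D" "(\<lambda>n. F n - H n) \<longlonglongrightarrow> D - D"
    by (intro tendsto_diff LIMSEQ_Suc F H)+
  then have "eventually (\<lambda>n. \<bar>F (Suc n) - F n\<bar> < 1 / 20) sequentially"
    "eventually (\<lambda>n. \<bar>F n - H n\<bar> < 1 / 20) sequentially"
    using tendstoD[of _ "D - D" sequentially "1 / 20"] by (simp_all add: dist_real_def)
  then have "eventually (\<lambda>n. \<bar>F (Suc n) - F n\<bar> < 1 / 20 \<and> \<bar>F n - H n\<bar> < 1 / 20) sequentially"
    by (rule eventually_conj)
  then obtain n where n: "\<bar>F (Suc n) - F n\<bar> < 1 / 20" "\<bar>F n - H n\<bar> < 1 / 20"
    using eventually_happens'[OF sequentially_bot] by blast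
  let ?u = "100 ^ n * x"
  have cos_small: "\<bar>cos ?u\<bar> < 1 / 2"
    using n(1) full_period_quotient[of x n] full_period_quotient[of x "Suc n"]
    unfolding F_def[symmetric] sum.lessThan_Suc abs_le_iff abs_less_iff by (intro conjI; linarith)
  have "\<bar>2 / pi * sin ?u\<bar> < 1 / 4"
    using n(2) full_period_quotient[of x n] half_period_quotient[of x n]
    unfolding F_def[symmetric] H_def[symmetric] abs_le_iff abs_less_iff by (intro conjI; linarith)
  then have "\<bar>sin ?u\<bar> < 1 / 2"
    using pi_less_4 by (simp add: abs_mult field_simps)
  then have "(sin ?u)\<^sup>2 < (1 / 2)\<^sup>2"
    using power_strict_mono[of "\<bar>sin ?u\<bar>" "1 / 2" 2] by simp
  moreover have "(cos ?u)\<^sup>2 < (1 / 2)\<^sup>2"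
    using power_strict_mono[OF cos_small, of 2] by simp
  ultimately show False
    using sin_cos_squared_add[of ?u] by (simp add: power2_eq_square)
qed

section \<open>Infinite derivatives\<close>

text \<open>\<open>baby_Sard\<close> speaks of maps between spaces \<open>real^'n\<close>, so
  \<open>g\<close> is transported to \<open>real^1\<close>, where the zero derivative has rank 0 <
  1. The image is then projected back.\<close>

lemma negligible_image_derivative_0:
  fixes g :: "real \<Rightarrow> real"
  assumes "\<And>u. u \<in> T \<Longrightarrow> (g has_derivative (\<lambda>_. 0)) (at u within T)"
  shows "negligible (g ` T)"
proof -
  define G :: "real^1 \<Rightarrow> real^1" where "G = (\<lambda>v. vec (g (v $ 1)))"
  define T' :: "(real^1) set" where "T' = vec ` T"
  have "negligible (G ` T')"
  proof (rule baby_Sard)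
    fix v assume "v \<in> T'"
    then obtain u where u: "u \<in> T" "v = vec u" unfolding T'_def by blast
    have img: "(\<lambda>v. v $ 1) ` T' = T"
      by (auto simp: T'_def image_image)
    have "(g has_derivative (\<lambda>_. 0)) (at (v $ 1) within (\<lambda>v. v $ 1) ` T')"
      using assms[OF u(1)] u(2) img by simp
    moreover have "((\<lambda>v::real^1. v $ 1) has_derivative (\<lambda>v. v $ 1)) (at v within T')"
      by (intro bounded_linear_imp_has_derivative bounded_linear_vec_nth)
    ultimately have "((\<lambda>v. g (v $ 1)) has_derivative (\<lambda>_. 0)) (at v within T')"
      using has_derivative_in_compose[of "\<lambda>v. v $ 1" "\<lambda>v. v $ 1" v T' g "\<lambda>_. 0"] by simp
    from bounded_linear.has_derivative[OF linear_vec[THEN linear_conv_bounded_linear[THEN iffD1]] this]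
    show "(G has_derivative (\<lambda>_. 0)) (at v within T')"
      by (simp add: G_def)
    show "rank (matrix (\<lambda>_::real^1. 0::real^1)) < CARD(1)"
      by (simp add: matrix_def zero_vec_def[symmetric])
  qed simp
  then have "negligible ((\<lambda>v. v $ 1) ` G ` T')"
    by (rule negligible_differentiable_image_negligible[rotated])
      (auto intro!: linear_imp_differentiable_on bounded_linear_vec_nth bounded_linear.linear)
  moreover have "(\<lambda>v. v $ 1) ` G ` T' = g ` T"
    by (auto simp: G_def T'_def image_image)
  ultimately show ?thesis by simp
qed

text \<open>The set is covered by countably many pieces on which \<open>f\<close> expands distances.
  Each piece is the image of the inverse of \<open>f\<close> restricted to it, and infinite slope of
  \<open>f\<close> means slope 0 of that inverse.\<close>

lemma negligible_derivative_at_top: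
  fixes f :: "real \<Rightarrow> real"
  shows "negligible {x \<in> S. filterlim (\<lambda>y. (f y - f x) / (y - x)) at_top (at x within S)}"
    (is "negligible ?E")
proof -
  have ex: "\<exists>\<delta>>0. \<forall>y\<in>S. \<bar>y - x\<bar> < \<delta> \<longrightarrow> K * \<bar>y - x\<bar> \<le> \<bar>f y - f x\<bar>" if "x \<in> ?E" for x K
  proof -
    have "eventually (\<lambda>y. (f y - f x) / (y - x) \<ge> K) (at x within S)"
      using that by (auto simp: filterlim_at_top)
    then obtain \<delta> where "\<delta> > 0"
      and \<delta>: "\<And>y. y \<in> S \<Longrightarrow> y \<noteq> x \<Longrightarrow> dist y x < \<delta> \<Longrightarrow> K \<le> (f y - f x) / (y - x)"
      unfolding eventually_at by blast
    have "K * \<bar>y - x\<bar> \<le> \<bar>f y - f x\<bar>" if "y \<in> S" "\<bar>y - x\<bar> < \<delta>" for y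
    proof (cases "y = x")
      case False
      then have "K \<le> \<bar>f y - f x\<bar> / \<bar>y - x\<bar>"
        using \<delta>[of y] that by (simp add: dist_real_def flip: abs_divide)
      then show ?thesis using False by (simp add: field_simps)
    qed simp
    then show ?thesis using \<open>\<delta> > 0\<close> by blast
  qed
  \<comment> \<open>The radius around \<open>q\<close> is half the range of the expansion estimate,
    so any two points of one piece are within that range. Rational centres keep the family
    countable.\<close>
  define A where "A q n = {x \<in> ?E. \<bar>x - of_rat q\<bar> < 1 / (2 * real (Suc n)) \<and>
      (\<forall>y\<in>S. \<bar>y - x\<bar> < 1 / real (Suc n) \<longrightarrow> \<bar>y - x\<bar> \<le> \<bar>f y - f x\<bar>)}" for q :: rat and n
  have neg: "negligible (A q n)" for q n
  proof -
    let ?A = "A q n"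
    have AE: "?A \<subseteq> ?E" by (auto simp: A_def)
    have expand: "\<bar>y - x\<bar> \<le> \<bar>f y - f x\<bar>" if "x \<in> ?A" "y \<in> ?A" for x y
    proof -
      have "\<bar>x - of_rat q\<bar> < 1 / (2 * real (Suc n))" "\<bar>y - of_rat q\<bar> < 1 / (2 * real (Suc n))"
        using that by (simp_all only: A_def mem_Collect_eq)
      then have "\<bar>y - x\<bar> < 1 / (2 * real (Suc n)) + 1 / (2 * real (Suc n))"
        by linarith
      also have "\<dots> = 1 / real (Suc n)" by (simp add: field_simps)
      finally show ?thesis using that by (auto simp: A_def)
    qed
    then have inj: "inj_on f ?A" by (fastforce intro!: inj_onI)
    let ?g = "inv_into ?A f"
    have "(?g has_derivative (\<lambda>_. 0)) (at u within f ` ?A)" if "u \<in> f ` ?A" for u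
    proof -
      obtain x where x: "x \<in> ?A" "u = f x" using \<open>u \<in> f ` ?A\<close> by blast
      show ?thesis
        unfolding has_derivative_within_alt
      proof (intro conjI allI impI)
        fix e :: real assume "e > 0"
        \<comment> \<open>Slope at least \<open>1 / e\<close> for \<open>f\<close> becomes slope at
          most \<open>e\<close> for the inverse.\<close>
        obtain \<delta> where "\<delta> > 0"
          and \<delta>: "\<And>y. y \<in> S \<Longrightarrow> \<bar>y - x\<bar> < \<delta> \<Longrightarrow> 1 / e * \<bar>y - x\<bar> \<le> \<bar>f y - f x\<bar>"
          using ex[of x "1 / e"] x(1) AE by blast
        have "norm (?g v - ?g u - 0) \<le> e * norm (v - u)"
          if "v \<in> f ` ?A" "norm (v - u) < \<delta>" for v
        proof -
          obtain y where y: "y \<in> ?A" "v = f y" using \<open>v \<in> f ` ?A\<close> by blast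
          \<comment> \<open>Expansion turns closeness of the values \<open>u\<close>,
            \<open>v\<close> into closeness of their preimages, so the same \<open>\<delta>\<close>
            serves for the inverse.\<close>
          have "\<bar>y - x\<bar> < \<delta>"
            using expand[OF x(1) y(1)] that(2) x(2) y(2) by simp
          then have "1 / e * \<bar>y - x\<bar> \<le> \<bar>f y - f x\<bar>"
            using \<delta> y(1) AE by blast
          then show ?thesis
            using \<open>e > 0\<close> inj x y by (simp add: field_simps)
        qed
        then show "\<exists>d>0. \<forall>v\<in>f ` ?A. norm (v - u) < d \<longrightarrow>
            norm (?g v - ?g u - 0) \<le> e * norm (v - u)"
          using \<open>\<delta> > 0\<close> by blast
      qed simp
    qed
    then have "negligible (?g ` f ` ?A)" by (rule negligible_image_derivative_0)
    then show ?thesis using inj by (simp add: image_image)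
  qed
  have "?E \<subseteq> (\<Union>q n. A q n)"
  proof
    fix x assume x: "x \<in> ?E"
    obtain \<delta> where "\<delta> > 0" and \<delta>: "\<And>y. y \<in> S \<Longrightarrow> \<bar>y - x\<bar> < \<delta> \<Longrightarrow> \<bar>y - x\<bar> \<le> \<bar>f y - f x\<bar>"
      using ex[OF x, of 1] by auto
    obtain n where n: "1 / real (Suc n) < \<delta>"
      using nat_approx_posE[OF \<open>\<delta> > 0\<close>] by blast
    obtain r where "r \<in> \<rat>" "x < r" "r < x + 1 / (2 * real (Suc n))"
      using Rats_dense_in_real[of x "x + 1 / (2 * real (Suc n))"] by auto
    then obtain q where "x < of_rat q" "of_rat q < x + 1 / (2 * real (Suc n))"
      by (auto elim: Rats_cases)
    then have "x \<in> A q n" using x n \<delta> unfolding A_def by force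
    then show "x \<in> (\<Union>q n. A q n)" by blast
  qed
  moreover have "negligible (\<Union>q n. A q n)"
  proof (rule negligible_countable_Union)
    show "countable (range (\<lambda>q. \<Union>n. A q n))" by simp
    show "negligible B" if "B \<in> range (\<lambda>q. \<Union>n. A q n)" for B
      using that neg negligible_countable_Union[of "range (A _)"] by auto
  qed
  ultimately show ?thesis by (rule negligible_subset[rotated])
qed

lemma negligible_infinite_derivative_01: "negligible {x \<in> {0..1}. has_infinite_derivative_01 f x}"
proof -
  have "(- f y - - f x) / (y - x) = - ((f y - f x) / (y - x))" for x y
    by (simp add: minus_divide_left)
  then have "{x \<in> {0..1}. has_infinite_derivative_01 f x} =
      {x \<in> {0..1}. filterlim (\<lambda>y. (f y - f x) / (y - x)) at_top (at x within {0..1})} \<union>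
      {x \<in> {0..1}. filterlim (\<lambda>y. (- f y - - f x) / (y - x)) at_top (at x within {0..1})}"
    unfolding has_infinite_derivative_01_def
    by (auto simp: filterlim_uminus_at_top)
  then show ?thesis
    using negligible_derivative_at_top[of "{0..1}" f]
      negligible_derivative_at_top[of "{0..1}" "\<lambda>x. - f x"] by simp
qed

section \<open>Graphs close to their chords\<close>

text \<open>The order is by abscissa. A middle point \<open>q\<close> is compared with the chord
  point \<open>m\<close> above or below it: \<open>m\<close> is no farther from either end than the
  ends are from each other, and moving from \<open>m\<close> to \<open>q\<close> costs at most
  \<open>c - 1\<close> times that distance.\<close>

lemma sym_c_monotone_graph01:
  fixes f :: "real \<Rightarrow> real"
  assumes chord: "\<And>x h t. h > 0 \<Longrightarrow> 0 \<le> t \<Longrightarrow> t \<le> 1 \<Longrightarrow>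
      \<bar>f (x + t * h) - (1 - t) * f x - t * f (x + h)\<bar> \<le> (c - 1) * h"
  shows "sym_c_monotone c (graph01 f)"
proof -
  define r where "r = {(p, q). p \<in> graph01 f \<and> q \<in> graph01 f \<and> fst p \<le> fst q}"
  have "linear_order_on (graph01 f) r"
    unfolding linear_order_on_def partial_order_on_def preorder_on_def
  proof (intro conjI)
    show "refl_on (graph01 f) r" "trans r" "r \<subseteq> graph01 f \<times> graph01 f" "total_on (graph01 f) r"
      by (auto simp: r_def refl_on_def trans_def total_on_def)
    show "antisym r" by (auto simp: r_def graph01_def antisym_def)
  qed
  moreover have "max (dist p q) (dist q s) \<le> c * dist p s"
    if pqs: "(p, q) \<in> r" "p \<noteq> q" "(q, s) \<in> r" "q \<noteq> s" for p q s
  proof -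
    have "p \<in> graph01 f" "q \<in> graph01 f" "s \<in> graph01 f" and le: "fst p \<le> fst q" "fst q \<le> fst s"
      using pqs by (simp_all add: r_def)
    then obtain x y z where p: "p = (x, f x)" and q: "q = (y, f y)" and s: "s = (z, f z)"
      unfolding graph01_def by blast
    with le pqs(2,4) have "x < y" "y < z" by (auto simp: less_le)
    define h t where "h = z - x" and "t = (y - x) / h"
    have h: "h > 0" and z: "z = x + h" using \<open>x < y\<close> \<open>y < z\<close> by (auto simp: h_def)
    have t: "0 \<le> t" "t \<le> 1" and y: "y = x + t * h"
      using \<open>x < y\<close> \<open>y < z\<close> h by (auto simp: t_def field_simps) (auto simp: h_def)
    define m where "m = p + t *\<^sub>R (s - p)"
    have "m = (y, (1 - t) * f x + t * f z)"
      by (simp add: m_def p s y z algebra_simps)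
    then have "dist m q = \<bar>f y - (1 - t) * f x - t * f z\<bar>"
      by (simp add: q dist_Pair_Pair dist_real_def)
    also have "\<dots> \<le> (c - 1) * h"
      using chord[OF h t] by (simp add: y z)
    finally have mq: "dist m q \<le> (c - 1) * h" .
    \<comment> \<open>The chord bound itself forces \<open>c\<close> to be at least 1, which is
      needed to replace \<open>h\<close> by the larger \<open>dist p s\<close>.\<close>
    then have "0 \<le> (c - 1) * h"
      using zero_le_dist order_trans by blast
    then have "c - 1 \<ge> 0" using h by (simp add: zero_le_mult_iff)
    moreover have "h \<le> dist p s"
      using h dist_fst_le[of p s] by (simp add: p s z dist_real_def)
    ultimately have mq': "dist m q \<le> (c - 1) * dist p s"
      using mq by (meson mult_left_mono order_trans)
    have "dist p m = t * dist p s"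
      using t by (simp add: m_def dist_norm norm_minus_commute)
    then have pm: "dist p m \<le> dist p s"
      using t mult_right_mono[of t 1 "dist p s"] by simp
    have "s - m = (1 - t) *\<^sub>R (s - p)"
      by (simp add: m_def algebra_simps)
    then have "dist s m = (1 - t) * dist s p"
      using t by (simp add: dist_norm)
    then have sm: "dist s m \<le> dist p s"
      using t mult_right_mono[of "1 - t" 1 "dist s p"] by (simp add: dist_commute)
    have "dist p q \<le> dist p m + dist m q" "dist q s \<le> dist s m + dist m q"
      by (metis dist_triangle, metis dist_commute dist_triangle)
    with mq' pm sm show ?thesis
      by (simp add: algebra_simps)
  qed
  ultimately show ?thesis unfolding sym_c_monotone_def by blast
qed

section \<open>Scaling the series and assembling the result\<close>

theorem theorem5p1:
  fixes c :: real
  assumes "c > 1"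
  shows "\<exists>f :: real \<Rightarrow> real. continuous_on {0..1} f \<and>
           sym_c_monotone c (graph01 f) \<and>
           deriv_points_01 f \<in> null_sets lebesgue"
proof (intro exI conjI)
  \<comment> \<open>The gap of the series is at most \<open>6 * h\<close>; this factor brings it
    down to the admissible \<open>(c - 1) * h\<close>.\<close>
  define \<epsilon> where "\<epsilon> = (c - 1) / 6"
  define f where "f x = \<epsilon> * lacunary x" for x
  have \<epsilon>: "\<epsilon> > 0" "c - 1 = 6 * \<epsilon>" using assms by (auto simp: \<epsilon>_def)
  show "continuous_on {0..1} f"
    unfolding f_def by (intro continuous_intros continuous_on_lacunary)
  show "sym_c_monotone c (graph01 f)"
  proof (rule sym_c_monotone_graph01)
    fix x h t :: real assume ht: "h > 0" "0 \<le> t" "t \<le> 1"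
    have "f (x + t * h) - (1 - t) * f x - t * f (x + h) = \<epsilon> * chord_gap lacunary x h t"
      by (simp add: f_def chord_gap_def algebra_simps)
    then show "\<bar>f (x + t * h) - (1 - t) * f x - t * f (x + h)\<bar> \<le> (c - 1) * h"
      using chord_gap_lacunary[OF ht] \<epsilon> by (simp add: abs_mult)
  qed
  have "\<not> f differentiable (at x within {0..1})" if "0 \<le> x" "x < 1" for x
  proof
    assume "f differentiable (at x within {0..1})"
    then have "(\<lambda>y. 1 / \<epsilon> * f y) differentiable (at x within {0..1})"
      by (intro differentiable_mult differentiable_const)
    then show False
      using lacunary_not_differentiable[OF that] \<epsilon> by (simp add: f_def)
  qed
  \<comment> \<open>The right endpoint, where no steps to the right are available, is simply put
    into the null set.\<close>
  then have "deriv_points_01 f \<subseteq> {1} \<union> {x \<in> {0..1}. has_infinite_derivative_01 f x}"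
    unfolding deriv_points_01_def by force
  then have "negligible (deriv_points_01 f)"
    by (rule negligible_subset[rotated]) (intro negligible_Un negligible_sing negligible_infinite_derivative_01)
  then show "deriv_points_01 f \<in> null_sets lebesgue"
    by (simp add: negligible_iff_null_sets)
qed

end
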